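(* Let $H$ be a finite graph that has an even decomposition. Then there exists $c_H>0$ such that for all sufficiently large $n$, $r_H(n)\geq n^{c_H}$, and hence $d^{\mathrm{lin}}_H(n)\leq n^{-c_H}$. More precisely, if $H$ has $v(H)\geq 3$ vertices, then for every $\varepsilon>0$ and all sufficiently large $n$, $r_H(n)\geq (1-\varepsilon)n^{1/(v(H)-2)}$.
   Context: An even decomposition of a graph $H$ is a sequence of vertex sets $V(H)=V_0\supset V_1\supset\cdots\supset V_k=\emptyset$ such that for every $i\in[k]$, the set $V_{i-1}\setminus V_i$ is independent in $H$ and the number of edges of $H$ between $V_{i-1}\setminus V_i$ and $V_i$ is even. $K_n$ is the complete graph on $[n]$. An edge coloring $\chi$ of $K_n$ admits an even-chromatic copy of $H$ if there is an injective map $f\colon V(H)\to[n]$ such that every color appears on an even number (possibly zero) of the edges $f(u)f(v)$, $uv\in E(H)$. $r_H(n)$ is the minimum number of colors in an edge coloring of $K_n$ admitting no even-chromatic copy of $H$ ($\infty$ if none exists). Graphs on $[n]$ form the $\mathbb{F}_2$-vector space $\mathbb{F}_2^{K_n}$ with addition given by symmetric difference of edge sets; a graph $G$ on $[n]$ is a copy of $H$ if for some $S\subseteq[n]$, $G[S]\cong H$ and all vertices outside $S$ are isolated in $G$. $d^{\mathrm{lin}}_H(n)=2^{-\binom n2}\max\{|\mathcal C|:\mathcal C\le\mathbb{F}_2^{K_n}\text{ a subspace containing no copy of }H\}$. *)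

theory Defs
  imports Complex_Main "HOL-Library.Extended_Real" "HOL-Library.Ramsey"
begin

text \<open>A simple graph is given by its vertex set and its edge set; edges are 2-element sets of vertices.\<close>

definition finite_graph :: "'a set \<Rightarrow> 'a set set \<Rightarrow> bool" where
  "finite_graph V E \<longleftrightarrow> finite V \<and> E \<subseteq> [V]\<^bsup>2\<^esup>"

definition edges_between :: "'a set set \<Rightarrow> 'a set \<Rightarrow> 'a set \<Rightarrow> 'a set set" where
  "edges_between E A B = {e \<in> E. \<exists>a\<in>A. \<exists>b\<in>B. e = {a, b}}"

definition even_decomposition :: "'a set \<Rightarrow> 'a set set \<Rightarrow> nat \<Rightarrow> (nat \<Rightarrow> 'a set) \<Rightarrow> bool" where
  "even_decomposition V E k W \<longleftrightarrow>
     W 0 = V \<and> W k = {} \<and>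
     (\<forall>i\<in>{1..k}.
        W i \<subset> W (i - 1) \<and>
        indep (W (i - 1) - W i) E \<and>
        even (card (edges_between E (W (i - 1) - W i) (W i))))"

definition has_even_decomposition :: "'a set \<Rightarrow> 'a set set \<Rightarrow> bool" where
  "has_even_decomposition V E \<longleftrightarrow> (\<exists>k W. even_decomposition V E k W)"

definition complete_edges :: "nat \<Rightarrow> nat set set" where
  "complete_edges n = [{1..n}]\<^bsup>2\<^esup>"

text \<open>For an edge \<open>e = {u, v}\<close> the image \<open>f ` e\<close> is the edge \<open>{f u, f v}\<close>.\<close>

definition admits_even_chromatic_copy ::
    "'a set \<Rightarrow> 'a set set \<Rightarrow> nat \<Rightarrow> (nat set \<Rightarrow> 'c) \<Rightarrow> bool" where
  "admits_even_chromatic_copy V E n \<chi> \<longleftrightarrow>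
     (\<exists>f. inj_on f V \<and> f ` V \<subseteq> {1..n} \<and> (\<forall>c. even (card {e \<in> E. \<chi> (f ` e) = c})))"

text \<open>
  Only the values of \<open>\<chi>\<close> on the edges of the complete graph matter, and those that occur are the
  colors used; since there are finitely many edges, natural numbers suffice as colors.
  The infimum in \<^typ>\<open>enat\<close> is a minimum on nonempty sets and is infinite on the empty set.
\<close>

definition r_even :: "'a set \<Rightarrow> 'a set set \<Rightarrow> nat \<Rightarrow> enat" where
  "r_even V E n =
     Inf {enat (card (\<chi> ` complete_edges n)) | \<chi> :: nat set \<Rightarrow> nat.
            \<not> admits_even_chromatic_copy V E n \<chi>}"

text \<open>
  Graphs on \<open>{1..n}\<close> are identified with their edge sets, the subsets of \<open>complete_edges n\<close>.
  As the only scalars are 0 and 1, a linear subspace over the two-element field is a set that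
  contains the zero vector and is closed under addition.
\<close>

definition graph_subspace :: "nat \<Rightarrow> nat set set set \<Rightarrow> bool" where
  "graph_subspace n C \<longleftrightarrow>
     C \<subseteq> Pow (complete_edges n) \<and> {} \<in> C \<and> (\<forall>G\<in>C. \<forall>G'\<in>C. sym_diff G G' \<in> C)"

definition induced_edges :: "'a set set \<Rightarrow> 'a set \<Rightarrow> 'a set set" where
  "induced_edges G S = {e \<in> G. e \<subseteq> S}"

definition graph_isomorphic :: "'a set \<Rightarrow> 'a set set \<Rightarrow> 'b set \<Rightarrow> 'b set set \<Rightarrow> bool" where
  "graph_isomorphic V E V' E' \<longleftrightarrow>
     (\<exists>f. bij_betw f V V' \<and> (\<forall>u\<in>V. \<forall>v\<in>V. {u, v} \<in> E \<longleftrightarrow> {f u, f v} \<in> E'))"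

definition is_copy :: "'a set \<Rightarrow> 'a set set \<Rightarrow> nat \<Rightarrow> nat set set \<Rightarrow> bool" where
  "is_copy V E n G \<longleftrightarrow>
     (\<exists>S \<subseteq> {1..n}. graph_isomorphic S (induced_edges G S) V E \<and>
        (\<forall>v \<in> {1..n} - S. \<forall>e\<in>G. v \<notin> e))"

text \<open>
  The supremum of a set of natural numbers is its maximum if the set is finite and nonempty, and
  0 if the set is empty. The latter occurs when every subspace contains a copy, that is, when the
  graph has no edges and at most \<open>n\<close> vertices.
\<close>

definition d_lin :: "'a set \<Rightarrow> 'a set set \<Rightarrow> nat \<Rightarrow> real" where
  "d_lin V E n =
     real (Sup {card C | C. graph_subspace n C \<and> (\<forall>G\<in>C. \<not> is_copy V E n G)}) / 2 ^ (n choose 2)"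

end

theory Submission
  imports Defs
begin

text \<open>
  Let \<open>A = V\<^sub>0 - V\<^sub>1\<close>. By double counting, any set of \<open>N\<close> vertices of a clique colored with \<open>r\<close> colors contains
  disjoint sets \<open>X\<close> and \<open>Y\<close> with \<open>|X| = |A|\<close> and \<open>|Y| \<ge> (1 - o(1)) N / r ^ |A|\<close> such that all edges between
  \<open>X\<close> and \<open>Y\<close> have the same color. Embed \<open>A\<close> onto \<open>X\<close> and, recursively, \<open>V\<^sub>1\<close> into \<open>Y\<close>: as \<open>A\<close> is independent
  and sends an even number of edges to \<open>V\<^sub>1\<close>, all color multiplicities stay even. This succeeds as
  soon as \<open>N \<ge> (1 + \<delta>) r ^ (v - 2)\<close> and \<open>r\<close> is large.

  For the linear density, color an edge by its coset modulo the subspace \<open>C\<close>. An even-chromatic copy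
  is a sum of pairs of edges from the same coset and hence lies in \<open>C\<close>, so if \<open>C\<close> contains no copy,
  then its index is at least \<open>r\<^sub>H(n)\<close>.
\<close>

section \<open>Binomial estimates and monochromatic complete bipartite subgraphs\<close>

text \<open>Each of the \<open>a\<close> factors of the falling factorial
  \<open>d (d - 1) ... (d - a + 1)\<close> is at least the last one, and
  \<open>a \<le> Suc d\<close> keeps that one nonnegative.\<close>

lemma fact_binomial_ge_power:
  assumes "a \<le> Suc d"
  shows "(real d - real a + 1) ^ a \<le> fact a * real (d choose a)"
proof -
  have "fact a * real (d choose a) = (\<Prod>i = 0..<a. real d - real i)"
    by (simp add: binomial_gbinomial gbinomial_mult_fact)
  moreover have "(\<Prod>i = 0..<a. real d - real a + 1) \<le> (\<Prod>i = 0..<a. real d - real i)"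
    using assms by (intro prod_mono) auto
  ultimately show ?thesis by simp
qed

text \<open>With \<open>t = d - a + 1\<close> the left side is the tangent of \<open>t ^ a\<close>
  at \<open>m\<close>, which lies below the curve by Bernoulli's inequality for
  \<open>t \<ge> 0\<close> and is nonpositive otherwise. It is affine in \<open>d\<close>, so
  summing it over colors needs only the sum of the degrees.\<close>

lemma fact_binomial_ge_tangent:
  fixes m :: real
  assumes "m > 0" "a \<ge> 1"
  shows "m ^ a + real a * m ^ (a - 1) * (real d - (real a - 1) - m) \<le> fact a * real (d choose a)"
proof -
  define t where "t = real d - real a + 1"
  have ma: "m ^ a = m * m ^ (a - 1)"
    using assms by (cases a) auto
  have "m ^ a + real a * m ^ (a - 1) * (t - m) \<le> fact a * real (d choose a)"
  proof (cases "a \<le> Suc d")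
    case True
    then have "t \<ge> 0"
      by (simp add: t_def)
    then have "1 + real a * (t / m - 1) \<le> (1 + (t / m - 1)) ^ a"
      using \<open>m > 0\<close> by (intro Bernoulli_inequality) auto
    then have "m ^ a * (1 + real a * (t / m - 1)) \<le> m ^ a * (t / m) ^ a"
      using \<open>m > 0\<close> by (intro mult_left_mono) auto
    also have "\<dots> = t ^ a"
      using \<open>m > 0\<close> by (simp add: power_divide)
    also have "\<dots> \<le> fact a * real (d choose a)"
      using fact_binomial_ge_power[OF True] by (simp add: t_def)
    finally have "m ^ a * (1 + real a * (t / m - 1)) \<le> fact a * real (d choose a)" .
    moreover have "m ^ a * (1 + real a * (t / m - 1)) = m ^ a + real a * m ^ (a - 1) * (t - m)"
      unfolding ma using \<open>m > 0\<close> by (simp add: field_simps)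
    ultimately show ?thesis
      by simp
  next
    case False
    then have "t \<le> 0"
      by (simp add: t_def)
    then have "m + real a * (t - m) \<le> m + real a * (- m)"
      using assms by (intro add_left_mono mult_left_mono) auto
    also have "\<dots> \<le> 0"
      using assms by simp
    finally have "m ^ (a - 1) * (m + real a * (t - m)) \<le> 0"
      using assms by (intro mult_nonneg_nonpos) auto
    then have "m ^ a + real a * m ^ (a - 1) * (t - m) \<le> 0"
      by (simp add: ma algebra_simps)
    then show ?thesis
      by (meson fact_ge_zero mult_nonneg_nonneg of_nat_0_le_iff order_trans)
  qed
  moreover have "real d - (real a - 1) = t"
    by (simp add: t_def)
  ultimately show ?thesis
    by simp
qed

text \<open>The Kovari--Sos--Turan argument: count stars with \<open>a\<close> leaves, centre \<open>y\<close> and a single color, first by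
  \<open>y\<close> (convexity enters through tangents, so no color class needs to be large) and then by leaf set.\<close>

lemma exists_monochromatic_complete_bipartite:
  fixes \<chi> :: "'b set \<Rightarrow> 'c" and m :: real
  assumes fin: "finite S" "finite P" and col: "\<chi> ` [S]\<^bsup>2\<^esup> \<subseteq> P"
    and r: "card P > 0" and a: "a \<ge> 1"
    and m: "m = (real (card S) - 1) / real (card P) - (real a - 1)" "m > 0"
  obtains X Y c where "X \<subseteq> S" "card X = a" "Y \<subseteq> S - X"
    "\<And>x y. x \<in> X \<Longrightarrow> y \<in> Y \<Longrightarrow> \<chi> {x, y} = c"
    "m ^ a \<le> real (card Y) * real (card S) ^ (a - 1)"
proof -
  define N where "N = card S"
  \<comment> \<open>\<open>D c y\<close> is the neighborhood of \<open>y\<close> in color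
    \<open>c\<close>, and \<open>Z c X\<close> is the set of common neighbors of \<open>X\<close> in
    that color. As \<open>y\<close> is not in \<open>D c y\<close>, the set \<open>Z c X\<close>
    avoids \<open>X\<close> automatically.\<close>
  define D where "D c y = {x \<in> S. x \<noteq> y \<and> \<chi> {x, y} = c}" for c y
  define Z where "Z c X = {y \<in> S. X \<subseteq> D c y}" for c X
  have finD: "finite (D c y)" for c y
    using fin by (simp add: D_def)
  have "N \<noteq> 0"
  proof
    assume "N = 0"
    then have "m = - 1 / real (card P) - (real a - 1)"
      using m(1) by (simp add: N_def)
    moreover have "- 1 / real (card P) \<le> 0"
      by simp
    ultimately show False
      using m(2) a by linarith
  qed
  then have N: "N \<ge> 1"
    by simp
  have "real a - 1 < (real N - 1) / real (card P)"
    using m by (simp add: N_def)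
  also have "\<dots> \<le> (real N - 1) / 1"
    using r N by (intro divide_left_mono) auto
  finally have aN: "a \<le> N"
    by simp
  have deg: "(\<Sum>c\<in>P. real (card (D c y))) = real N - 1" if "y \<in> S" for y
  proof -
    have sub: "(\<lambda>x. \<chi> {x, y}) ` (S - {y}) \<subseteq> P"
    proof
      fix p assume "p \<in> (\<lambda>x. \<chi> {x, y}) ` (S - {y})"
      then obtain x where "p = \<chi> {x, y}" "x \<in> S" "x \<noteq> y"
        by blast
      moreover from this have "{x, y} \<in> [S]\<^bsup>2\<^esup>"
        using that by simp
      ultimately show "p \<in> P"
        using col by blast
    qed
    have "(\<Sum>c\<in>P. card (D c y)) = (\<Sum>c\<in>P. \<Sum>x\<in>{x \<in> S - {y}. \<chi> {x, y} = c}. 1)"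
      by (intro sum.cong refl) (auto simp: D_def intro!: arg_cong[where f = card])
    also have "\<dots> = (\<Sum>x\<in>S - {y}. 1)"
      using fin sub by (intro sum.group) auto
    also have "\<dots> = N - 1"
      using that fin by (simp add: N_def)
    finally have "real (\<Sum>c\<in>P. card (D c y)) = real (N - 1)"
      by (rule arg_cong)
    then show ?thesis
      using N by simp
  qed
  \<comment> \<open>The mean of the color degrees at \<open>y\<close> is
    \<open>(card S - 1) / card P\<close>, so after the shift by \<open>a - 1\<close> their mean is
    exactly \<open>m\<close>. The linear terms of the tangents at \<open>m\<close> therefore
    cancel.\<close>
  have star: "real (card P) * m ^ a \<le> (\<Sum>c\<in>P. fact a * real (card (D c y) choose a))" if "y \<in> S" for y
  proof -
    have "(\<Sum>c\<in>P. m ^ a + real a * m ^ (a - 1) * (real (card (D c y)) - (real a - 1) - m))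
        = real (card P) * m ^ a + real a * m ^ (a - 1)
           * ((\<Sum>c\<in>P. real (card (D c y))) - real (card P) * ((real a - 1) + m))"
      by (simp add: sum.distrib sum_subtractf flip: sum_distrib_left) (simp add: algebra_simps)
    also have "\<dots> = real (card P) * m ^ a"
      using r by (simp add: deg[OF that] m(1) N_def)
    finally have "real (card P) * m ^ a =
        (\<Sum>c\<in>P. m ^ a + real a * m ^ (a - 1) * (real (card (D c y)) - (real a - 1) - m))" ..
    also have "\<dots> \<le> (\<Sum>c\<in>P. fact a * real (card (D c y) choose a))"
      by (intro sum_mono fact_binomial_ge_tangent m a)
    finally show ?thesis .
  qed
  \<comment> \<open>Both sides count the stars of color \<open>c\<close> with \<open>a\<close>
    leaves, first by leaf set and then by centre.\<close>
  have count: "(\<Sum>X\<in>[S]\<^bsup>a\<^esup>. card (Z c X)) = (\<Sum>y\<in>S. card (D c y) choose a)" for c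
  proof -
    have "(\<Sum>X\<in>[S]\<^bsup>a\<^esup>. card (Z c X)) = (\<Sum>X\<in>[S]\<^bsup>a\<^esup>. \<Sum>y\<in>{y \<in> S. X \<subseteq> D c y}. 1)"
      by (simp add: Z_def)
    also have "\<dots> = (\<Sum>y\<in>S. \<Sum>X\<in>{X \<in> [S]\<^bsup>a\<^esup>. X \<subseteq> D c y}. 1)"
      using fin by (intro sum.swap_restrict) (auto simp: finite_imp_finite_nsets)
    also have "\<dots> = (\<Sum>y\<in>S. card (D c y) choose a)"
    proof (intro sum.cong refl)
      fix y
      have "{X \<in> [S]\<^bsup>a\<^esup>. X \<subseteq> D c y} = {X. X \<subseteq> D c y \<and> card X = a}"
        using finD[of c y] by (auto simp: nsets_def D_def intro: finite_subset)
      then show "(\<Sum>X\<in>{X \<in> [S]\<^bsup>a\<^esup>. X \<subseteq> D c y}. 1) = card (D c y) choose a"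
        using n_subsets[OF finD] by simp
    qed
    finally show ?thesis .
  qed
  \<comment> \<open>If all common neighborhoods were too small, then counting by leaf set and
    \<open>(N choose a) * fact a \<le> N ^ a\<close> would bound the number of stars strictly below
    the lower bound from \<open>star\<close>.\<close>
  have "\<exists>c\<in>P. \<exists>X\<in>[S]\<^bsup>a\<^esup>. m ^ a \<le> real (card (Z c X)) * real N ^ (a - 1)"
  proof (rule ccontr)
    assume "\<not> ?thesis"
    then have less: "real (card (Z c X)) * real N ^ (a - 1) < m ^ a" if "c \<in> P" "X \<in> [S]\<^bsup>a\<^esup>" for c X
      using that by force
    have ne: "[S]\<^bsup>a\<^esup> \<noteq> {}" and card_ns: "card ([S]\<^bsup>a\<^esup>) = N choose a"
      using aN fin by (auto simp: N_def nsets_eq_empty_iff card_nsets)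
    have "real N * (real (card P) * m ^ a) = (\<Sum>y\<in>S. real (card P) * m ^ a)"
      by (simp add: N_def)
    also have "\<dots> \<le> (\<Sum>y\<in>S. \<Sum>c\<in>P. fact a * real (card (D c y) choose a))"
      by (intro sum_mono star)
    also have "\<dots> = fact a * (\<Sum>c\<in>P. real (\<Sum>y\<in>S. card (D c y) choose a))"
      by (subst sum.swap) (simp add: sum_distrib_left)
    also have "\<dots> = fact a * (\<Sum>c\<in>P. \<Sum>X\<in>[S]\<^bsup>a\<^esup>. real (card (Z c X)))"
      by (simp flip: count)
    finally have "real N * (real (card P) * m ^ a) * real N ^ (a - 1)
        \<le> fact a * (\<Sum>c\<in>P. \<Sum>X\<in>[S]\<^bsup>a\<^esup>. real (card (Z c X))) * real N ^ (a - 1)"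
      by (rule mult_right_mono) simp
    also have "\<dots> = fact a * (\<Sum>c\<in>P. \<Sum>X\<in>[S]\<^bsup>a\<^esup>. real (card (Z c X)) * real N ^ (a - 1))"
      by (simp add: sum_distrib_right)
    also have "\<dots> < fact a * (\<Sum>c\<in>P. \<Sum>X\<in>[S]\<^bsup>a\<^esup>. m ^ a)"
      using fin r ne less
      by (intro mult_strict_left_mono sum_strict_mono finite_imp_finite_nsets) auto
    also have "\<dots> = real (card P) * m ^ a * real ((N choose a) * fact a)"
      by (simp add: card_ns[unfolded N_def] N_def)
    also have "\<dots> \<le> real (card P) * m ^ a * real (N ^ a)"
      using m(2) by (intro mult_left_mono of_nat_mono binomial_fact_pow) auto
    also have "real (N ^ a) = real N * real N ^ (a - 1)"
      using a by (cases a) auto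
    finally show False
      by (simp add: mult_ac)
  qed
  then obtain c X where "X \<in> [S]\<^bsup>a\<^esup>" and big: "m ^ a \<le> real (card (Z c X)) * real N ^ (a - 1)"
    by blast
  moreover have "Z c X \<subseteq> S - X" "\<And>x y. x \<in> X \<Longrightarrow> y \<in> Z c X \<Longrightarrow> \<chi> {x, y} = c"
    by (auto simp: Z_def D_def)
  ultimately show ?thesis
    using that[of X "Z c X" c] by (auto simp: nsets_def N_def)
qed

section \<open>Embedding along an even decomposition\<close>

text \<open>The condition \<open>e \<subseteq> V\<close> lets \<open>E\<close> stay fixed while
  \<open>V\<close> shrinks along the decomposition, and the target \<open>S\<close> is explicit so
  that the recursion can continue inside \<open>Y\<close>.\<close>

definition even_chromatic_embedding ::
    "'a set set \<Rightarrow> 'a set \<Rightarrow> ('b set \<Rightarrow> 'c) \<Rightarrow> 'b set \<Rightarrow> ('a \<Rightarrow> 'b) \<Rightarrow> bool" where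
  "even_chromatic_embedding E V \<chi> S f \<longleftrightarrow>
     inj_on f V \<and> f ` V \<subseteq> S \<and> (\<forall>c. even (card {e \<in> E. e \<subseteq> V \<and> \<chi> (f ` e) = c}))"

lemma even_chromatic_embedding_card_le_1:
  assumes E: "\<And>e. e \<in> E \<Longrightarrow> card e = 2" and "finite V" "card V \<le> 1" "f ` V \<subseteq> S"
  shows "even_chromatic_embedding E V \<chi> S f"
proof -
  have "\<not> e \<subseteq> V" if "e \<in> E" for e
    using E[OF that] card_mono[OF \<open>finite V\<close>, of e] \<open>card V \<le> 1\<close> by linarith
  then have "{e \<in> E. e \<subseteq> V \<and> \<chi> (f ` e) = c} = {}" for c
    by blast
  moreover have "inj_on f V"
    using assms(2,3) by (auto simp: card_le_Suc0_iff_eq inj_on_def)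
  ultimately show ?thesis
    using assms(4) unfolding even_chromatic_embedding_def by (metis card.empty even_zero)
qed

text \<open>By independence an edge inside \<open>V\<close> lies inside \<open>V'\<close> or joins
  \<open>V - V'\<close> to \<open>V'\<close>. Edges of the second kind all receive color
  \<open>c\<close> and are even in number, so no parity changes.\<close>

lemma even_chromatic_embedding_extend:
  assumes E: "\<And>e. e \<in> E \<Longrightarrow> card e = 2" and fin: "finite V" and V': "V' \<subseteq> V"
    and ind: "indep (V - V') E" and ev: "even (card (edges_between E (V - V') V'))"
    and emb: "even_chromatic_embedding E V' \<chi> Y f"
    and X: "X \<subseteq> S" "finite X" "card X = card (V - V')" and Y: "Y \<subseteq> S - X"
    and mono: "\<And>x y. x \<in> X \<Longrightarrow> y \<in> Y \<Longrightarrow> \<chi> {x, y} = c"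
  shows "\<exists>g. even_chromatic_embedding E V \<chi> S g"
proof -
  define A where "A = V - V'"
  have "finite A"
    using fin by (simp add: A_def)
  then obtain h where h: "bij_betw h A X"
    using X finite_same_card_bij by (metis A_def)
  define g where "g v = (if v \<in> A then h v else f v)" for v
  have f: "inj_on f V'" "f ` V' \<subseteq> Y" "\<And>c. even (card {e \<in> E. e \<subseteq> V' \<and> \<chi> (f ` e) = c})"
    using emb by (auto simp: even_chromatic_embedding_def)
  have V: "V = A \<union> V'" "A \<inter> V' = {}"
    using V' by (auto simp: A_def)
  have gA: "g v = h v" if "v \<in> A" for v
    using that by (simp add: g_def)
  have gV': "g v = f v" if "v \<in> V'" for v
    using that V by (auto simp: g_def)
  have hX: "h v \<in> X" if "v \<in> A" for v
    using h that by (auto simp: bij_betw_def)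
  have "inj_on g A"
    using h by (simp add: bij_betw_def gA inj_on_def)
  moreover have "inj_on g V'"
    using f(1) by (simp add: gV' inj_on_def)
  moreover have "g ` A \<inter> g ` V' = {}"
    using Y f(2) by (auto simp: gA gV' dest!: hX)
  ultimately have inj: "inj_on g V"
    unfolding V(1) by (subst inj_on_Un) blast
  have "g ` V \<subseteq> S"
    using subset_trans[OF f(2) Y] X(1) hX unfolding V(1) by (auto simp: gA gV')
  moreover have "even (card {e \<in> E. e \<subseteq> V \<and> \<chi> (g ` e) = q})" for q
  proof -
    define B where "B = edges_between E A V'"
    have B: "e \<subseteq> V \<and> \<not> e \<subseteq> V' \<and> \<chi> (g ` e) = c" if e: "e \<in> B" for e
    proof -
      obtain a b where "a \<in> A" "b \<in> V'" "e = {a, b}"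
        using e by (auto simp: B_def edges_between_def)
      moreover have "\<chi> {h a, f b} = c"
        using \<open>a \<in> A\<close> \<open>b \<in> V'\<close> f(2) hX by (intro mono) auto
      ultimately show ?thesis
        using V by (auto simp: gA gV')
    qed
    \<comment> \<open>An edge that leaves \<open>V'\<close> has an endpoint in \<open>A\<close>, and
      independence keeps the other endpoint out of \<open>A\<close>.\<close>
    have split: "e \<in> B" if e: "e \<in> E" "e \<subseteq> V" "\<not> e \<subseteq> V'" for e
    proof -
      obtain u v where uv: "e = {u, v}" "u \<noteq> v" "u \<notin> V'"
        using E[OF e(1)] e(3) by (auto simp: card_2_iff insert_commute)
      then have "u \<in> A"
        using e V by auto
      moreover have "v \<notin> A"
        using ind \<open>u \<in> A\<close> uv e(1) by (auto simp: indep_def A_def)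
      ultimately show ?thesis
        using uv e V by (auto simp: B_def edges_between_def)
    qed
    have img: "g ` e = f ` e" if "e \<subseteq> V'" for e
      using that gV' by (intro image_cong) auto
    have eq: "{e \<in> E. e \<subseteq> V \<and> \<chi> (g ` e) = q} =
        {e \<in> E. e \<subseteq> V' \<and> \<chi> (f ` e) = q} \<union> (if q = c then B else {})"
    proof (intro set_eqI)
      fix e
      have "e \<in> B \<Longrightarrow> e \<in> E"
        by (simp add: B_def edges_between_def)
      then show "e \<in> {e \<in> E. e \<subseteq> V \<and> \<chi> (g ` e) = q} \<longleftrightarrow>
          e \<in> {e \<in> E. e \<subseteq> V' \<and> \<chi> (f ` e) = q} \<union> (if q = c then B else {})"
        using B[of e] split[of e] V' img[of e] by (cases "e \<in> B"; cases "e \<subseteq> V'") auto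
    qed
    have fins: "finite {e \<in> E. e \<subseteq> V' \<and> \<chi> (f ` e) = q}" "finite B"
      by (rule finite_subset[of _ "Pow V"]; use fin V B in auto)+
    have "card {e \<in> E. e \<subseteq> V \<and> \<chi> (g ` e) = q} =
        card {e \<in> E. e \<subseteq> V' \<and> \<chi> (f ` e) = q} + card (if q = c then B else {})"
      unfolding eq using fins B by (intro card_Un_disjoint) auto
    then show ?thesis
      using f(3) ev by (simp add: B_def A_def)
  qed
  ultimately show ?thesis
    using inj unfolding even_chromatic_embedding_def by blast
qed

text \<open>Peeling off a part of size \<open>a\<close> costs a factor \<open>card P ^ a\<close>. The exponent is \<open>card V - 2\<close> rather than
  \<open>card V - 1\<close> because a set with more than one element already contains two vertices.\<close>

lemma even_decomposition_embedding:
  fixes V :: "'a set" and \<delta> :: real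
  assumes E: "\<And>e. e \<in> E \<Longrightarrow> card e = 2"
  assumes "even_decomposition V E k W" "finite V" "card V \<ge> 2" "\<delta> > 0"
  shows "\<exists>r0. \<forall>S P (\<chi> :: 'b set \<Rightarrow> 'c).
    finite S \<longrightarrow> finite P \<longrightarrow> \<chi> ` [S]\<^bsup>2\<^esup> \<subseteq> P \<longrightarrow> r0 \<le> card P \<longrightarrow>
    (1 + \<delta>) * real (card P) ^ (card V - 2) \<le> real (card S) \<longrightarrow>
    (\<exists>f. even_chromatic_embedding E V \<chi> S f)"
  using assms(2-)
proof (induction k arbitrary: V W \<delta>)
  \<comment> \<open>A decomposition of length 0 forces \<open>V = {}\<close>, against
    \<open>card V \<ge> 2\<close>.\<close>
  case 0
  then show ?case
    by (auto simp: even_decomposition_def)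
next
  case (Suc k)
  define V' where "V' = W 1"
  define a where "a = card (V - V')"
  have V': "V' \<subset> V" and ind: "indep (V - V') E" and ev: "even (card (edges_between E (V - V') V'))"
    using Suc.prems(1) unfolding even_decomposition_def V'_def
    by (metis One_nat_def Suc_le_mono atLeastAtMost_iff diff_Suc_1 le0 order_refl)+
  have dec: "even_decomposition V' E k (\<lambda>i. W (Suc i))"
    unfolding even_decomposition_def
  proof (intro conjI ballI)
    fix i assume i: "i \<in> {1..k}"
    then have "Suc i \<in> {1..Suc k}" "Suc (i - 1) = i"
      by auto
    then show "W (Suc i) \<subset> W (Suc (i - 1))" "indep (W (Suc (i - 1)) - W (Suc i)) E"
      "even (card (edges_between E (W (Suc (i - 1)) - W (Suc i)) (W (Suc i))))"
      using Suc.prems(1) unfolding even_decomposition_def by (metis diff_Suc_1)+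
  qed (use Suc.prems(1) in \<open>auto simp: even_decomposition_def V'_def\<close>)
  have finV': "finite V'"
    using V' Suc.prems(2) by (auto intro: finite_subset)
  have cardV: "card V = card V' + a"
    using V' finV' card_mono[of V V'] Suc.prems(2) by (auto simp: a_def card_Diff_subset)
  have a: "a \<ge> 1"
    using psubset_card_mono[OF Suc.prems(2) V'] cardV by linarith
  note extend = even_chromatic_embedding_extend[OF E Suc.prems(2) psubset_imp_subset[OF V'] ind ev]
  \<comment> \<open>If nothing remains, any injection will do; if one vertex remains,
    \<open>Y\<close> only has to be nonempty; only from two vertices on does the size of
    \<open>Y\<close> matter for the recursion.\<close>
  consider "card V' = 0" | "card V' = 1" | "card V' \<ge> 2"
    by linarith
  then show ?case
  proof cases
    case 1
    then have "V' = {}"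
      using finV' by simp
    show ?thesis
    \<comment> \<open>The threshold only has to force \<open>card S \<ge> card V\<close>: for
      \<open>card V = 2\<close> this follows from \<open>\<delta> > 0\<close>, and otherwise the
      exponent is at least 1.\<close>
    proof (intro exI[of _ "card V"] allI impI)
      fix S :: "'b set" and P and \<chi> :: "'b set \<Rightarrow> 'c"
      assume S: "finite S" and P: "card V \<le> card P"
        and big: "(1 + \<delta>) * real (card P) ^ (card V - 2) \<le> real (card S)"
      have "card V \<le> card S"
      proof (cases "card V = 2")
        case True
        then show ?thesis
          using big Suc.prems(4) by simp
      next
        case False
        then have "card P ^ 1 \<le> card P ^ (card V - 2)"
          using Suc.prems(3) P by (intro power_increasing) auto
        then have "real (card V) \<le> 1 * real (card P) ^ (card V - 2)"
          using P by (simp flip: of_nat_power)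
        also have "\<dots> \<le> (1 + \<delta>) * real (card P) ^ (card V - 2)"
          using Suc.prems(4) by (intro mult_right_mono) auto
        finally show ?thesis
          using big by simp
      qed
      then obtain X where X: "X \<subseteq> S" "card X = card V" "finite X"
        using obtain_subset_with_card_n by metis
      \<comment> \<open>With an empty \<open>Y\<close> the monochromaticity condition is vacuous and
        the color arbitrary.\<close>
      have "even_chromatic_embedding E V' \<chi> {} f" for f
        using \<open>V' = {}\<close> by (intro even_chromatic_embedding_card_le_1 E) auto
      from extend[OF _ this, where X = X and S = S and c = undefined] show "\<exists>f. even_chromatic_embedding E V \<chi> S f"
        using X \<open>V' = {}\<close> by auto
    qed
  next
    case 2
    then obtain z where z: "V' = {z}"
      by (auto simp: card_1_singleton_iff)
    have v: "card V - 2 = a - 1"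
      using 2 cardV by simp
    show ?thesis
    \<comment> \<open>The summand \<open>1 / \<delta>\<close> serves \<open>a = 2\<close>, where
      \<open>card P + 1 < (1 + \<delta>) * card P\<close> is needed; the summand \<open>a\<close>
      serves \<open>a \<ge> 3\<close>, where \<open>a * card P\<close> is compared with the square
      of \<open>card P\<close>.\<close>
    proof (intro exI[of _ "a + 2 + nat \<lceil>1 / \<delta>\<rceil>"] allI impI)
      fix S :: "'b set" and P and \<chi> :: "'b set \<Rightarrow> 'c"
      assume S: "finite S" and P: "finite P" "\<chi> ` [S]\<^bsup>2\<^esup> \<subseteq> P"
        and r: "a + 2 + nat \<lceil>1 / \<delta>\<rceil> \<le> card P"
        and big: "(1 + \<delta>) * real (card P) ^ (card V - 2) \<le> real (card S)"
      define m where "m = (real (card S) - 1) / real (card P) - (real a - 1)"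
      have r\<delta>: "real (card P) > 1 / \<delta>"
        using r by linarith
      \<comment> \<open>This is \<open>m > 0\<close> with the denominator cleared.\<close>
      have "real (card P) * (real a - 1) < real (card S) - 1"
      proof -
        consider "a = 1" | "a = 2" | "a \<ge> 3"
          using a by linarith
        then show ?thesis
        proof cases
          case 1
          then show ?thesis
            using big Suc.prems(4) by (simp add: v)
        next
          case 2
          then show ?thesis
            using big r\<delta> Suc.prems(4) by (simp add: v field_simps)
        next
          case 3
          have "real (card P) * (real a - 1) + 1 \<le> real (card P) * real (card P)"
          proof -
            have "real (card P) * (real a - 1) + 1 \<le> real (card P) * (real a - 1) + real (card P)"
              using r by linarith
            also have "\<dots> = real (card P) * real a"
              by (simp add: algebra_simps)
            also have "\<dots> \<le> real (card P) * real (card P)"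
              using r by (intro mult_left_mono) auto
            finally show ?thesis .
          qed
          also have "\<dots> = real (card P) ^ 2"
            by (simp add: power2_eq_square)
          also have "\<dots> \<le> real (card P) ^ (card V - 2)"
            using 3 r v by (intro power_increasing) auto
          also have "\<dots> < (1 + \<delta>) * real (card P) ^ (card V - 2)"
            using Suc.prems(4) r by simp
          finally show ?thesis
            using big by linarith
        qed
      qed
      then have m: "m > 0"
        using r by (simp add: m_def field_simps)
      obtain X Y c where XY: "X \<subseteq> S" "card X = a" "Y \<subseteq> S - X"
        "\<And>x y. x \<in> X \<Longrightarrow> y \<in> Y \<Longrightarrow> \<chi> {x, y} = c"
        "m ^ a \<le> real (card Y) * real (card S) ^ (a - 1)"
        using exists_monochromatic_complete_bipartite[OF S P _ a m_def m] r by auto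
      have "0 < m ^ a"
        using m by simp
      then have "Y \<noteq> {}"
        using XY(5) by auto
      then obtain y where "y \<in> Y"
        by auto
      then have "even_chromatic_embedding E V' \<chi> Y (\<lambda>_. y)"
        using z by (intro even_chromatic_embedding_card_le_1 E) auto
      from extend[OF _ this, where X = X and S = S and c = c] show "\<exists>f. even_chromatic_embedding E V \<chi> S f"
        using XY S by (auto simp: a_def intro: finite_subset)
    qed
  next
    case 3
    define v where "v = card V' - 2"
    have v: "card V - 2 = v + a"
      using 3 cardV by (simp add: v_def)
    \<comment> \<open>Half of \<open>\<delta>\<close> is kept for the recursion; the other half pays
      for the lower-order loss in the size of \<open>Y\<close>.\<close>
    have "\<delta> / 2 > 0"
      using Suc.prems(4) by simp
    then obtain r0 where r0: "\<forall>S P (\<chi> :: 'b set \<Rightarrow> 'c).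
      finite S \<longrightarrow> finite P \<longrightarrow> \<chi> ` [S]\<^bsup>2\<^esup> \<subseteq> P \<longrightarrow> r0 \<le> card P \<longrightarrow>
      (1 + \<delta> / 2) * real (card P) ^ v \<le> real (card S) \<longrightarrow>
      (\<exists>f. even_chromatic_embedding E V' \<chi> S f)"
      using Suc.IH[OF dec finV' 3] unfolding v_def by blast
    show ?thesis
    \<comment> \<open>The ceiling is chosen to give
      \<open>(1 + \<delta>) * (1 - a^2 / q) \<ge> 1 + \<delta> / 2\<close> for
      \<open>q = card P\<close>.\<close>
    proof (intro exI[of _ "r0 + 1 + nat \<lceil>2 * (real a)\<^sup>2 * (1 + \<delta>) / \<delta>\<rceil>"] allI impI)
      fix S :: "'b set" and P and \<chi> :: "'b set \<Rightarrow> 'c"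
      assume S: "finite S" and P: "finite P" "\<chi> ` [S]\<^bsup>2\<^esup> \<subseteq> P"
        and r: "r0 + 1 + nat \<lceil>2 * (real a)\<^sup>2 * (1 + \<delta>) / \<delta>\<rceil> \<le> card P"
        and big: "(1 + \<delta>) * real (card P) ^ (card V - 2) \<le> real (card S)"
      define m where "m = (real (card S) - 1) / real (card P) - (real a - 1)"
      define N where "N = real (card S)"
      define q where "q = real (card P)"
      \<comment> \<open>The relative loss against the ideal degree \<open>N / q\<close>, so that
        \<open>m = N / q * (1 - t)\<close>. Since \<open>N > q ^ a\<close>, it is at most
        \<open>a / q\<close>.\<close>
      define t where "t = (1 + (real a - 1) * q) / N"
      note \<delta> = \<open>\<delta> > 0\<close>
      have q1: "q \<ge> 1"
        using r by (simp add: q_def)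
      have q2: "q > 2 * (real a)\<^sup>2 * (1 + \<delta>) / \<delta>"
        using r unfolding q_def by linarith
      then have q\<delta>: "2 * (real a)\<^sup>2 * (1 + \<delta>) < q * \<delta>"
        using \<delta> by (simp add: field_simps)
      have "q ^ a \<le> q ^ (v + a)"
        using q1 by (intro power_increasing) auto
      also have "\<dots> < (1 + \<delta>) * q ^ (v + a)"
        using \<delta> q1 by simp
      also have Nbig: "\<dots> \<le> N"
        using big by (simp add: N_def q_def v)
      finally have qN: "q ^ a < N" .
      then have N0: "N > 0"
        using q1 by (smt (verit) zero_le_power)
      have t: "real a * t \<le> (real a)\<^sup>2 / q"
      proof -
        have "(1 + (real a - 1) * q) * q \<le> real a * q ^ a"
        proof (cases "a = 1")
          case True
          then show ?thesis by simp
        next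
          case False
          have "(1 + (real a - 1) * q) * q \<le> (q + (real a - 1) * q) * q"
            using q1 by (intro mult_right_mono) auto
          also have "\<dots> = real a * q ^ 2"
            by (simp add: algebra_simps power2_eq_square)
          also have "\<dots> \<le> real a * q ^ a"
            using False a q1 by (intro mult_left_mono power_increasing) auto
          finally show ?thesis .
        qed
        also have "\<dots> \<le> real a * N"
          using qN by (intro mult_left_mono) auto
        finally have "t \<le> real a / q"
          using q1 N0 by (simp add: t_def field_simps)
        then have "real a * t \<le> real a * (real a / q)"
          by (intro mult_left_mono) auto
        then show ?thesis
          by (simp add: power2_eq_square)
      qed
      have small: "(1 + \<delta>) * ((real a)\<^sup>2 / q) \<le> \<delta> / 2"
        using q\<delta> q1 by (simp add: field_simps)
      have "(real a)\<^sup>2 / q < 1"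
      proof -
        have "2 * (real a)\<^sup>2 * (1 + \<delta>) < q * (1 + \<delta>)"
          using q\<delta> q1 by (simp add: algebra_simps)
        then have "2 * (real a)\<^sup>2 < q"
          using \<delta> by simp
        moreover have "(real a)\<^sup>2 \<ge> 0"
          by simp
        ultimately show ?thesis
          using q1 by (simp add: field_simps)
      qed
      moreover have "t \<le> real a * t"
      proof -
        have "t \<ge> 0"
          using a q1 N0 by (simp add: t_def)
        then show ?thesis
          using a mult_right_mono[of 1 "real a" t] by simp
      qed
      ultimately have t1: "t < 1"
        using t by linarith
      have m_eq: "m = N / q * (1 - t)"
        using q1 N0 by (simp add: m_def t_def N_def q_def field_simps)
      then have m: "m > 0"
        using q1 N0 t1 by simp
      obtain X Y c where XY: "X \<subseteq> S" "card X = a" "Y \<subseteq> S - X"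
        "\<And>x y. x \<in> X \<Longrightarrow> y \<in> Y \<Longrightarrow> \<chi> {x, y} = c"
        "m ^ a \<le> real (card Y) * real (card S) ^ (a - 1)"
        using exists_monochromatic_complete_bipartite[OF S P _ a m_def m] r by auto
      \<comment> \<open>Bernoulli's inequality gives
        \<open>(1 + \<delta>) * (1 - t) ^ a \<ge> 1 + \<delta> / 2\<close>. Combine this with the
        lower bound on \<open>N\<close> and with \<open>(N * (1 - t)) ^ a = m ^ a * q ^ a\<close>,
        then cancel \<open>q ^ a * N ^ (a - 1)\<close>.\<close>
      have "(1 + \<delta> / 2) * q ^ v \<le> real (card Y)"
      proof -
        have "1 + \<delta> / 2 \<le> (1 + \<delta>) * (1 - (real a)\<^sup>2 / q)"
          using small by (simp only: right_diff_distrib) simp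
        also have "\<dots> \<le> (1 + \<delta>) * (1 + real a * (- t))"
          using t \<delta> by (intro mult_left_mono) auto
        also have "\<dots> \<le> (1 + \<delta>) * (1 + (- t)) ^ a"
          using t1 \<delta> by (intro mult_left_mono Bernoulli_inequality) auto
        finally have "(1 + \<delta> / 2) * q ^ v * q ^ a \<le> (1 + \<delta>) * (1 - t) ^ a * q ^ v * q ^ a"
          using q1 by (intro mult_right_mono) auto
        also have "\<dots> = (1 + \<delta>) * q ^ (v + a) * (1 - t) ^ a"
          by (simp add: power_add)
        also have "\<dots> \<le> N * (1 - t) ^ a"
          using Nbig t1 by (intro mult_right_mono) auto
        finally have "(1 + \<delta> / 2) * q ^ v * q ^ a * N ^ (a - 1) \<le> N * (1 - t) ^ a * N ^ (a - 1)"
          using N0 by (intro mult_right_mono) auto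
        also have "\<dots> = (N * (1 - t)) ^ a"
          using a by (cases a) (auto simp: power_mult_distrib)
        also have "\<dots> = m ^ a * q ^ a"
          using q1 by (simp add: m_eq power_divide power_mult_distrib)
        also have "\<dots> \<le> real (card Y) * N ^ (a - 1) * q ^ a"
          using XY(5) q1 by (intro mult_right_mono) (auto simp: N_def)
        finally have "(1 + \<delta> / 2) * q ^ v * (q ^ a * N ^ (a - 1)) \<le> real (card Y) * (q ^ a * N ^ (a - 1))"
          by (simp add: mult_ac)
        then show ?thesis
          using q1 N0 by (subst (asm) mult_le_cancel_right) auto
      qed
      moreover have "finite Y"
        using XY(3) S by (auto intro: finite_subset)
      moreover have "\<chi> ` [Y]\<^bsup>2\<^esup> \<subseteq> P"
        using P(2) nsets_mono[of Y S 2] XY(3) by blast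
      ultimately obtain f where "even_chromatic_embedding E V' \<chi> Y f"
        using r0[rule_format, of Y P \<chi>] P r by (auto simp: q_def)
      from extend[OF _ this, where X = X and S = S and c = c] show "\<exists>f. even_chromatic_embedding E V \<chi> S f"
        using XY S by (auto simp: a_def intro: finite_subset)
    qed
  qed
qed

section \<open>Lower bounds for the number of colors\<close>

text \<open>The infimum in \<open>enat\<close> is attained on a nonempty set and infinite on the
  empty one, so bounding each coloring separately suffices.\<close>

lemma ereal_le_r_evenI:
  assumes "\<And>\<chi> :: nat set \<Rightarrow> nat. \<not> admits_even_chromatic_copy V E n \<chi> \<Longrightarrow>
    x \<le> real (card (\<chi> ` complete_edges n))"
  shows "ereal x \<le> ereal_of_enat (r_even V E n)"
proof -
  define A where "A = {enat (card (\<chi> ` complete_edges n)) | \<chi> :: nat set \<Rightarrow> nat.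
            \<not> admits_even_chromatic_copy V E n \<chi>}"
  have r: "r_even V E n = Inf A"
    by (simp add: r_even_def A_def)
  show ?thesis
  proof (cases "A = {}")
    case True
    then show ?thesis
      by (simp add: r Inf_enat_def)
  next
    case False
    then have "Inf A \<in> A"
      unfolding Inf_enat_def by (auto intro: LeastI)
    then show ?thesis
      using assms by (auto simp: r A_def)
  qed
qed

lemma finite_complete_edges: "finite (complete_edges n)"
  by (simp add: complete_edges_def finite_imp_finite_nsets)

lemma card_complete_edges: "card (complete_edges n) = n choose 2"
  by (simp add: complete_edges_def card_nsets)

text \<open>This covers graphs with fewer than two vertices, which the embedding lemma leaves
  out.\<close>

lemma r_even_no_edges:
  assumes "finite V" "card V \<le> n"
  shows "r_even V {} n = \<infinity>"
proof -
  obtain f where f: "f ` V \<subseteq> {1..n}" "inj_on f V"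
    using card_le_inj[of V "{1..n}"] assms by auto
  then have "admits_even_chromatic_copy V {} n \<chi>" for \<chi> :: "nat set \<Rightarrow> nat"
    unfolding admits_even_chromatic_copy_def by (intro exI[of _ f]) auto
  then show ?thesis
    by (simp add: r_even_def Inf_enat_def)
qed

lemma filterlim_real_powr_sequentially:
  assumes "(a::real) > 0"
  shows "filterlim (\<lambda>n. real n powr a) at_top sequentially"
proof -
  have "filterlim (\<lambda>n. exp (a * ln (real n))) at_top sequentially"
    by (intro filterlim_compose[OF exp_at_top]
        filterlim_tendsto_pos_mult_at_top[OF tendsto_const assms]
        filterlim_compose[OF ln_at_top] filterlim_real_sequentially)
  then show ?thesis
    by (rule filterlim_mono_eventually[OF _ order_refl order_refl])
      (auto simp: powr_def intro!: eventually_mono[OF eventually_gt_at_top[of 0]])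
qed

context
  fixes V :: "'a set" and E :: "'a set set"
  assumes graph: "finite_graph V E" and dec: "has_even_decomposition V E"
begin

lemma card_edge: "e \<in> E \<Longrightarrow> card e = 2"
  using graph by (auto simp: finite_graph_def nsets_def)

text \<open>The embedding lemma depends only on the size of the palette, which may contain colors
  that never occur. Padding the palette to exactly \<open>r\<close> colors therefore also handles
  colorings with fewer than \<open>r0\<close> colors.\<close>

lemma few_colors_admits_even_chromatic_copy:
  fixes \<delta> :: real
  assumes "card V \<ge> 2" "\<delta> > 0"
  shows "\<exists>r0. \<forall>r n (\<chi> :: nat set \<Rightarrow> nat).
    r0 \<le> r \<longrightarrow> card (\<chi> ` complete_edges n) \<le> r \<longrightarrow>
    (1 + \<delta>) * real r ^ (card V - 2) \<le> real n \<longrightarrow> admits_even_chromatic_copy V E n \<chi>"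
proof -
  obtain k W where "even_decomposition V E k W"
    using dec by (auto simp: has_even_decomposition_def)
  from even_decomposition_embedding[OF card_edge this _ assms] graph
  obtain r0 where r0: "\<forall>S P (\<chi> :: nat set \<Rightarrow> nat).
    finite S \<longrightarrow> finite P \<longrightarrow> \<chi> ` [S]\<^bsup>2\<^esup> \<subseteq> P \<longrightarrow> r0 \<le> card P \<longrightarrow>
    (1 + \<delta>) * real (card P) ^ (card V - 2) \<le> real (card S) \<longrightarrow>
    (\<exists>f. even_chromatic_embedding E V \<chi> S f)"
    by (auto simp: finite_graph_def)
  show ?thesis
  proof (intro exI[of _ r0] allI impI)
    fix r n and \<chi> :: "nat set \<Rightarrow> nat"
    assume r: "r0 \<le> r" "card (\<chi> ` complete_edges n) \<le> r"
      and n: "(1 + \<delta>) * real r ^ (card V - 2) \<le> real n"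
    define Q where "Q = \<chi> ` complete_edges n"
    have "finite Q"
      by (simp add: Q_def finite_complete_edges)
    then have "infinite (- Q)"
      by simp
    then obtain B where B: "finite B" "card B = r - card Q" "B \<subseteq> - Q"
      using infinite_arbitrarily_large by blast
    have "card (Q \<union> B) = r"
      using B r \<open>finite Q\<close> by (subst card_Un_disjoint) (auto simp: Q_def)
    moreover have "\<chi> ` [{1..n}]\<^bsup>2\<^esup> \<subseteq> Q \<union> B"
      by (auto simp: Q_def complete_edges_def)
    ultimately obtain f where f: "even_chromatic_embedding E V \<chi> {1..n} f"
      using r0[rule_format, of "{1..n}" "Q \<union> B" \<chi>] B \<open>finite Q\<close> r n by auto
    have "{e \<in> E. e \<subseteq> V \<and> \<chi> (f ` e) = c} = {e \<in> E. \<chi> (f ` e) = c}" for c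
      using graph by (auto simp: finite_graph_def nsets_def)
    then show "admits_even_chromatic_copy V E n \<chi>"
      using f unfolding even_chromatic_embedding_def admits_even_chromatic_copy_def by auto
  qed
qed

lemma r_even_ge:
  fixes \<epsilon> :: real
  assumes V: "card V \<ge> 3" and "\<epsilon> > 0"
  shows "\<forall>\<^sub>F n in sequentially.
    ereal ((1 - \<epsilon>) * real n powr (1 / (real (card V) - 2))) \<le> ereal_of_enat (r_even V E n)"
proof (cases "\<epsilon> < 1")
  case False
  \<comment> \<open>For \<open>\<epsilon> \<ge> 1\<close> the bound is nonpositive.\<close>
  then have "ereal ((1 - \<epsilon>) * real n powr (1 / (real (card V) - 2))) \<le> ereal_of_enat (r_even V E n)" for n
    by (intro ereal_le_r_evenI order_trans[OF mult_nonpos_nonneg]) auto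
  then show ?thesis
    by simp
next
  case True
  define d where "d = card V - 2"
  have d: "d > 0" "real (card V) - 2 = real d"
    using V by (auto simp: d_def)
  \<comment> \<open>Chosen so that \<open>(1 + \<delta>) * x ^ d = n\<close> for
    \<open>x = (1 - \<epsilon>) * n powr (1 / d)\<close>.\<close>
  define \<delta> where "\<delta> = 1 / (1 - \<epsilon>) ^ d - 1"
  have pos: "0 < (1 - \<epsilon>) ^ d" and "(1 - \<epsilon>) ^ d < 1"
    using True \<open>\<epsilon> > 0\<close> d by (auto simp: power_less_one_iff)
  then have "\<delta> > 0"
    by (simp add: \<delta>_def)
  then obtain r0 where r0: "\<forall>r n (\<chi> :: nat set \<Rightarrow> nat).
    r0 \<le> r \<longrightarrow> card (\<chi> ` complete_edges n) \<le> r \<longrightarrow>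
    (1 + \<delta>) * real r ^ d \<le> real n \<longrightarrow> admits_even_chromatic_copy V E n \<chi>"
    using few_colors_admits_even_chromatic_copy[of \<delta>] V unfolding d_def by force
  have "filterlim (\<lambda>n. (1 - \<epsilon>) * real n powr (1 / real d)) at_top sequentially"
    using True d by (intro filterlim_tendsto_pos_mult_at_top[OF tendsto_const] filterlim_real_powr_sequentially) auto
  \<comment> \<open>This puts the integer part of the bound above the threshold \<open>r0\<close>
    and also rules out \<open>n = 0\<close>.\<close>
  then have "\<forall>\<^sub>F n in sequentially. real (Suc r0) \<le> (1 - \<epsilon>) * real n powr (1 / real d)"
    by (simp only: filterlim_at_top)
  then show ?thesis
  proof (rule eventually_mono)
    fix n
    define x where "x = (1 - \<epsilon>) * real n powr (1 / real d)"
    assume "real (Suc r0) \<le> (1 - \<epsilon>) * real n powr (1 / real d)"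
    then have x: "real (Suc r0) \<le> x"
      by (simp add: x_def)
    have n0: "n > 0"
      using x by (cases n) (auto simp: x_def)
    define r where "r = nat \<lfloor>x\<rfloor>"
    have r: "real r \<le> x" "r0 \<le> r"
      using x unfolding r_def by linarith+
    have "(1 + \<delta>) * real r ^ d \<le> (1 + \<delta>) * x ^ d"
      using r x \<open>\<delta> > 0\<close> by (intro mult_left_mono power_mono) auto
    also have "\<dots> = real n"
      using n0 d True by (simp add: \<delta>_def x_def power_mult_distrib powr_powr flip: powr_realpow)
    finally have n: "(1 + \<delta>) * real r ^ d \<le> real n" .
    have "ereal x \<le> ereal_of_enat (r_even V E n)"
    proof (rule ereal_le_r_evenI, rule ccontr)
      fix \<chi> :: "nat set \<Rightarrow> nat"
      assume no: "\<not> admits_even_chromatic_copy V E n \<chi>"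
        and "\<not> x \<le> real (card (\<chi> ` complete_edges n))"
      then have "card (\<chi> ` complete_edges n) \<le> r"
        unfolding r_def by linarith
      then show False
        using r0 r n no by blast
    qed
    then show "ereal ((1 - \<epsilon>) * real n powr (1 / (real (card V) - 2))) \<le> ereal_of_enat (r_even V E n)"
      by (simp only: x_def d(2))
  qed
qed

lemma r_even_infinite:
  assumes "card V \<le> 2"
  shows "\<forall>\<^sub>F n in sequentially. r_even V E n = \<infinity>"
proof (cases "card V = 2")
  case True
  \<comment> \<open>For \<open>card V = 2\<close> the exponent is 0, so with
    \<open>\<delta> = 1\<close> the size condition is just \<open>2 \<le> n\<close> and
    \<open>r\<close> may be as large as the coloring demands.\<close>
  then obtain r0 where r0: "\<forall>r n (\<chi> :: nat set \<Rightarrow> nat).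
    r0 \<le> r \<longrightarrow> card (\<chi> ` complete_edges n) \<le> r \<longrightarrow>
    2 \<le> real n \<longrightarrow> admits_even_chromatic_copy V E n \<chi>"
    using few_colors_admits_even_chromatic_copy[of 1] by auto
  have "r_even V E n = \<infinity>" if "n \<ge> 2" for n
  proof -
    have "admits_even_chromatic_copy V E n \<chi>" for \<chi> :: "nat set \<Rightarrow> nat"
      using r0[rule_format, of "max r0 (card (\<chi> ` complete_edges n))" \<chi> n] that by simp
    then show ?thesis
      by (simp add: r_even_def Inf_enat_def)
  qed
  then show ?thesis
    using eventually_sequentially by blast
next
  case False
  have "finite V"
    using graph by (simp add: finite_graph_def)
  have "[V]\<^bsup>2\<^esup> = {}"
    using False assms \<open>finite V\<close> by (simp add: nsets_eq_empty)
  then have "E = {}"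
    using graph by (simp add: finite_graph_def)
  then show ?thesis
    using r_even_no_edges[OF \<open>finite V\<close>] eventually_sequentially by blast
qed

lemma r_even_ge_powr:
  "\<exists>c::real. c > 0 \<and> (\<forall>\<^sub>F n in sequentially. ereal (real n powr c) \<le> ereal_of_enat (r_even V E n))"
proof (cases "card V \<ge> 3")
  case True
  define d where "d = real (card V) - 2"
  have d: "d > 0"
    using True by (simp add: d_def)
  \<comment> \<open>Halving the exponent absorbs the constant factor \<open>1 / 2\<close>.\<close>
  have ev: "\<forall>\<^sub>F n in sequentially. real n powr (1 / (2 * d)) \<le> (1 - 1 / 2) * real n powr (1 / d)"
  proof -
    have "\<forall>\<^sub>F n in sequentially. 2 \<le> real n powr (1 / (2 * d))"
      using filterlim_real_powr_sequentially[of "1 / (2 * d)"] d by (simp add: filterlim_at_top)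
    then show ?thesis
    proof eventually_elim
      case (elim n)
      then have "real n powr (1 / (2 * d)) * 2 \<le> real n powr (1 / (2 * d)) * real n powr (1 / (2 * d))"
        by (intro mult_left_mono) auto
      also have "\<dots> = real n powr (1 / d)"
        by (simp flip: powr_add)
      finally show ?case
        by simp
    qed
  qed
  have "\<forall>\<^sub>F n in sequentially. ereal ((1 - 1 / 2) * real n powr (1 / d)) \<le> ereal_of_enat (r_even V E n)"
    using r_even_ge[OF True, of "1 / 2"] by (simp add: d_def)
  with ev have "\<forall>\<^sub>F n in sequentially. ereal (real n powr (1 / (2 * d))) \<le> ereal_of_enat (r_even V E n)"
    by eventually_elim (meson ereal_less_eq(3) order_trans)
  then show ?thesis
    using d by (intro exI[of _ "1 / (2 * d)"]) auto
next
  case False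
  then have "\<forall>\<^sub>F n in sequentially. r_even V E n = \<infinity>"
    by (intro r_even_infinite) auto
  then have "\<forall>\<^sub>F n in sequentially. ereal (real n powr 1) \<le> ereal_of_enat (r_even V E n)"
    by eventually_elim simp
  then show ?thesis
    using zero_less_one by blast
qed

end

section \<open>Linear density through coset colorings\<close>

text \<open>A nonempty fibre of even size contains two edges, whose sum lies in \<open>C\<close>.
  Removing them preserves all parities, so induction on the size writes \<open>F\<close> as a sum of
  such pairs.\<close>

lemma graph_subspace_even_fibres:
  assumes C: "graph_subspace n C" and "finite F"
    and \<phi>: "\<And>e e'. e \<in> F \<Longrightarrow> e' \<in> F \<Longrightarrow> \<phi> e = \<phi> e' \<Longrightarrow> sym_diff {e} {e'} \<in> C"
    and "\<And>c. even (card {e \<in> F. \<phi> e = c})"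
  shows "F \<in> C"
  using assms(2-)
proof (induction "card F" arbitrary: F rule: less_induct)
  case less
  show ?case
  proof (cases "F = {}")
    case True
    then show ?thesis
      using C by (simp add: graph_subspace_def)
  next
    case False
    then obtain e where e: "e \<in> F"
      by auto
    define K where "K = {x \<in> F. \<phi> x = \<phi> e}"
    have "finite K" "e \<in> K" "even (card K)"
      using less.prems e by (auto simp: K_def)
    then have "K \<noteq> {e}"
      by auto
    then obtain e' where e': "e' \<in> F" "\<phi> e' = \<phi> e" "e' \<noteq> e"
      using \<open>e \<in> K\<close> by (auto simp: K_def)
    define F' where "F' = F - {e, e'}"
    have "card F' < card F"
      unfolding F'_def using e less.prems(1) by (intro psubset_card_mono) auto
    moreover have "even (card {x \<in> F'. \<phi> x = c})" for c
    proof (cases "c = \<phi> e")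
      case True
      then have "{x \<in> F'. \<phi> x = c} = {x \<in> F. \<phi> x = c} - {e, e'}"
        by (auto simp: F'_def)
      moreover have "card ({x \<in> F. \<phi> x = c} - {e, e'}) = card {x \<in> F. \<phi> x = c} - card {e, e'}"
        using True e e' by (intro card_Diff_subset) auto
      ultimately show ?thesis
        using less.prems(3) e'(3) by simp
    next
      case False
      then have "{x \<in> F'. \<phi> x = c} = {x \<in> F. \<phi> x = c}"
        using e' by (auto simp: F'_def)
      then show ?thesis
        using less.prems(3) by simp
    qed
    moreover have "finite F'"
      using less.prems(1) by (simp add: F'_def)
    ultimately have "F' \<in> C"
      using less.hyps[of F'] less.prems(2) by (auto simp: F'_def)
    moreover have "sym_diff {e} {e'} \<in> C"
      using less.prems(2)[OF e e'(1)] e'(2) by metis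
    ultimately have "sym_diff F' (sym_diff {e} {e'}) \<in> C"
      using C by (simp add: graph_subspace_def)
    also have "sym_diff F' (sym_diff {e} {e'}) = F"
      using e e' by (auto simp: F'_def)
    finally show ?thesis .
  qed
qed

lemma is_copy_image:
  assumes "finite_graph V E" "inj_on f V" "f ` V \<subseteq> {1..n}"
  shows "is_copy V E n ((`) f ` E)"
proof -
  have E: "e \<subseteq> V" if "e \<in> E" for e
    using assms(1) that by (auto simp: finite_graph_def nsets_def)
  have ind: "induced_edges ((`) f ` E) (f ` V) = (`) f ` E"
    using E by (auto simp: induced_edges_def)
  have mem: "f ` e \<in> (`) f ` E \<longleftrightarrow> e \<in> E" if "e \<subseteq> V" for e
  proof
    assume "f ` e \<in> (`) f ` E"
    then obtain e' where e': "e' \<in> E" "f ` e = f ` e'"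
      by blast
    then have "e = e'"
      using inj_on_image_eq_iff[OF assms(2) that E] by simp
    with e' show "e \<in> E"
      by simp
  qed blast
  \<comment> \<open>\<open>is_copy\<close> asks for an isomorphism from the copy to the original
    graph, hence the inverse of \<open>f\<close>.\<close>
  define g where "g = inv_into V f"
  have g: "g (f v) = v" if "v \<in> V" for v
    using that assms(2) by (simp add: g_def)
  have "bij_betw g (f ` V) V"
    using assms(2) unfolding g_def by (simp add: bij_betw_inv_into inj_on_imp_bij_betw)
  moreover have "{f u, f v} \<in> (`) f ` E \<longleftrightarrow> {u, v} \<in> E" if "u \<in> V" "v \<in> V" for u v
    using mem[of "{u, v}"] that by simp
  ultimately have "graph_isomorphic (f ` V) (induced_edges ((`) f ` E) (f ` V)) V E"
    unfolding graph_isomorphic_def ind by (intro exI[of _ g]) (auto simp: g)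
  moreover have "v \<notin> e" if "v \<in> {1..n} - f ` V" "e \<in> (`) f ` E" for v e
    using that E by blast
  ultimately show ?thesis
    using assms(3) unfolding is_copy_def by blast
qed

text \<open>The coloring sends an edge to its coset modulo \<open>C\<close>. The cosets that occur
  are disjoint translates of \<open>C\<close> inside the space of all graphs, which bounds their
  number; an even-chromatic copy would itself lie in \<open>C\<close>.\<close>

lemma graph_subspace_card_bound:
  assumes G: "finite_graph V E" and C: "graph_subspace n C"
    and no: "\<And>G. G \<in> C \<Longrightarrow> \<not> is_copy V E n G"
  obtains \<chi> :: "nat set \<Rightarrow> nat" where "\<not> admits_even_chromatic_copy V E n \<chi>"
    "card C * card (\<chi> ` complete_edges n) \<le> 2 ^ (n choose 2)"
proof -
  \<comment> \<open>The coset of the one-edge graph \<open>{e}\<close> modulo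
    \<open>C\<close>.\<close>
  define K where "K e = sym_diff {e} ` C" for e :: "nat set"
  have sub: "C \<subseteq> Pow (complete_edges n)" and zero: "{} \<in> C"
    and closed: "\<And>A B. A \<in> C \<Longrightarrow> B \<in> C \<Longrightarrow> sym_diff A B \<in> C"
    using C by (auto simp: graph_subspace_def)
  have inj: "inj (sym_diff A)" for A :: "nat set set"
    by (rule injI) blast
  have meet: "K e = K e' \<and> sym_diff {e} {e'} \<in> C" if meet: "K e \<inter> K e' \<noteq> {}" for e e'
  proof -
    obtain A B where AB: "A \<in> C" "B \<in> C" "sym_diff {e} A = sym_diff {e'} B"
      using meet by (auto simp: K_def)
    have "sym_diff {e} {e'} = sym_diff A B"
      using AB(3) by blast
    then have D: "sym_diff {e} {e'} \<in> C"
      using closed AB by simp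
    have "K e \<subseteq> K e'" if "sym_diff {e} {e'} \<in> C" for e e'
    proof
      fix X assume "X \<in> K e"
      then obtain A where A: "A \<in> C" "X = sym_diff {e} A"
        by (auto simp: K_def)
      have "X = sym_diff {e'} (sym_diff (sym_diff {e} {e'}) A)"
        unfolding A(2) by blast
      then show "X \<in> K e'"
        using closed[OF that A(1)] by (auto simp: K_def)
    qed
    from this[OF D] this[of e' e] D show ?thesis
      by (simp add: Un_commute)
  qed
  define T where "T = K ` complete_edges n"
  have finT: "finite T"
    by (simp add: T_def finite_complete_edges)
  then obtain num :: "nat set set set \<Rightarrow> nat" where num: "inj_on num T"
    using finite_imp_inj_to_nat_seg[of T] by metis
  define \<chi> where "\<chi> e = num (K e)" for e
  have "\<chi> ` complete_edges n = num ` T"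
    by (auto simp: \<chi>_def T_def)
  then have cardT: "card (\<chi> ` complete_edges n) = card T"
    using num by (simp add: card_image)
  have UT: "\<Union>T \<subseteq> Pow (complete_edges n)"
    using sub by (auto simp: T_def K_def)
  have "card C * card T = card (\<Union>T)"
  proof (rule card_partition[OF finT])
    show "finite (\<Union>T)"
      using UT by (rule finite_subset) (simp add: finite_complete_edges)
    show "card X = card C" if "X \<in> T" for X
      using that inj by (auto simp: T_def K_def intro!: card_image intro: inj_on_subset)
    show "X \<inter> Y = {}" if "X \<in> T" "Y \<in> T" "X \<noteq> Y" for X Y
      using that meet by (auto simp: T_def)
  qed
  also have "\<dots> \<le> card (Pow (complete_edges n))"
    using UT by (intro card_mono) (simp_all add: finite_complete_edges)
  also have "\<dots> = 2 ^ (n choose 2)"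
    by (simp add: card_Pow finite_complete_edges card_complete_edges)
  finally have "card C * card (\<chi> ` complete_edges n) \<le> 2 ^ (n choose 2)"
    by (simp add: cardT)
  moreover have "\<not> admits_even_chromatic_copy V E n \<chi>"
  proof
    assume "admits_even_chromatic_copy V E n \<chi>"
    then obtain f where f: "inj_on f V" "f ` V \<subseteq> {1..n}"
      and ev: "\<And>c. even (card {e \<in> E. \<chi> (f ` e) = c})"
      by (auto simp: admits_even_chromatic_copy_def)
    define F where "F = (`) f ` E"
    have E: "E \<subseteq> Pow V" "finite E"
      using G by (auto simp: finite_graph_def nsets_def intro: finite_subset[of _ "Pow V"])
    have injE: "inj_on ((`) f) E"
      using inj_on_image_Pow[OF f(1)] E by (auto intro: inj_on_subset)
    have F: "F \<subseteq> complete_edges n"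
    proof
      fix x assume "x \<in> F"
      then obtain e where e: "x = f ` e" "e \<in> E"
        by (auto simp: F_def)
      then have "e \<subseteq> V" "card e = 2" "finite e"
        using G by (auto simp: finite_graph_def nsets_def)
      then show "x \<in> complete_edges n"
        using f e by (auto simp: complete_edges_def nsets_def card_image inj_on_subset)
    qed
    have "F \<in> C"
    proof (rule graph_subspace_even_fibres[OF C, where \<phi> = \<chi>])
      show "finite F"
        using E by (simp add: F_def)
      show "sym_diff {e} {e'} \<in> C" if "e \<in> F" "e' \<in> F" "\<chi> e = \<chi> e'" for e e'
      proof -
        \<comment> \<open>Equal colors mean equal cosets; these are nonempty because
          \<open>C\<close> contains the zero vector, so \<open>meet\<close> applies.\<close>
        have "K e = K e'"
          using num that F by (auto simp: \<chi>_def T_def inj_on_def)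
        moreover have "K e \<noteq> {}"
          using zero by (auto simp: K_def)
        ultimately show ?thesis
          using meet[of e e'] by simp
      qed
      show "even (card {e \<in> F. \<chi> e = c})" for c
      proof -
        have "{e \<in> F. \<chi> e = c} = (`) f ` {e \<in> E. \<chi> (f ` e) = c}"
          by (auto simp: F_def)
        moreover have "inj_on ((`) f) {e \<in> E. \<chi> (f ` e) = c}"
          using injE by (rule inj_on_subset) auto
        ultimately show ?thesis
          using ev by (simp add: card_image)
      qed
    qed
    then show False
      using no is_copy_image[OF G f] by (simp add: F_def)
  qed
  ultimately show ?thesis
    using that by blast
qed

text \<open>Working with a positive real \<open>x\<close> below \<open>r_even\<close> avoids
  inverting an extended number and includes the case where \<open>r_even\<close> is
  infinite.\<close>

lemma d_lin_le_inverse: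
  assumes G: "finite_graph V E" and x: "x > 0" "ereal x \<le> ereal_of_enat (r_even V E n)"
  shows "d_lin V E n \<le> 1 / x"
proof -
  define A where "A = {card C | C. graph_subspace n C \<and> (\<forall>G\<in>C. \<not> is_copy V E n G)}"
  have bound: "real y * x \<le> 2 ^ (n choose 2)" if "y \<in> A" for y
  proof -
    from that obtain C where C: "y = card C" "graph_subspace n C" "\<And>G. G \<in> C \<Longrightarrow> \<not> is_copy V E n G"
      by (auto simp: A_def)
    then obtain \<chi> :: "nat set \<Rightarrow> nat" where \<chi>: "\<not> admits_even_chromatic_copy V E n \<chi>"
      and le: "card C * card (\<chi> ` complete_edges n) \<le> 2 ^ (n choose 2)"
      using graph_subspace_card_bound[OF G] by blast
    have "r_even V E n \<le> enat (card (\<chi> ` complete_edges n))"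
      unfolding r_even_def using \<chi> by (intro Inf_lower) auto
    then have "ereal_of_enat (r_even V E n) \<le> ereal_of_enat (enat (card (\<chi> ` complete_edges n)))"
      by (simp only: ereal_of_enat_le_iff)
    then have "x \<le> real (card (\<chi> ` complete_edges n))"
      using order_trans[OF x(2)] by fastforce
    then have "real y * x \<le> real y * real (card (\<chi> ` complete_edges n))"
      by (intro mult_left_mono) auto
    also have "\<dots> \<le> real (2 ^ (n choose 2))"
      using le unfolding C(1) by (simp only: of_nat_le_iff flip: of_nat_mult)
    finally show ?thesis
      by simp
  qed
  have "real (Sup A) * x \<le> 2 ^ (n choose 2)"
  proof (cases "A = {}")
    case True
    then show ?thesis
      by simp
  next
    case False
    \<comment> \<open>Boundedness makes \<open>A\<close> finite, so its supremum is a member and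
      inherits the bound.\<close>
    have "A \<subseteq> {..nat \<lceil>2 ^ (n choose 2) / x\<rceil>}"
    proof
      fix y assume "y \<in> A"
      then have "real y \<le> 2 ^ (n choose 2) / x"
        using bound x by (simp add: pos_le_divide_eq)
      then show "y \<in> {..nat \<lceil>2 ^ (n choose 2) / x\<rceil>}"
        unfolding atMost_iff by linarith
    qed
    then have "finite A"
      by (rule finite_subset) simp
    then have "Sup A \<in> A"
      using False by (simp add: Sup_nat_def)
    then show ?thesis
      by (rule bound)
  qed
  then show ?thesis
    using x by (simp add: d_lin_def A_def field_simps)
qed

theorem theorem1p5:
  fixes V :: "'a set" and E :: "'a set set"
  assumes "finite_graph V E"
    and "has_even_decomposition V E"
  shows "(\<exists>c::real. c > 0 \<and>
           (\<forall>\<^sub>F n in sequentially.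
              ereal (real n powr c) \<le> ereal_of_enat (r_even V E n) \<and>
              d_lin V E n \<le> real n powr (- c))) \<and>
         (card V \<ge> 3 \<longrightarrow>
           (\<forall>\<epsilon>::real. \<epsilon> > 0 \<longrightarrow>
             (\<forall>\<^sub>F n in sequentially.
                ereal ((1 - \<epsilon>) * real n powr (1 / (real (card V) - 2)))
                  \<le> ereal_of_enat (r_even V E n))))"
proof (intro conjI impI allI)
  obtain c :: real where "c > 0"
    and ev: "\<forall>\<^sub>F n in sequentially. ereal (real n powr c) \<le> ereal_of_enat (r_even V E n)"
    using r_even_ge_powr[OF assms] by blast
  have "\<forall>\<^sub>F n in sequentially. ereal (real n powr c) \<le> ereal_of_enat (r_even V E n) \<and>
              d_lin V E n \<le> real n powr (- c)"
    \<comment> \<open>For \<open>n > 0\<close> the value \<open>real n powr c\<close> is positive,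
      as its inversion requires.\<close>
    using ev eventually_gt_at_top[of 0]
  proof eventually_elim
    case (elim n)
    then have "d_lin V E n \<le> 1 / real n powr c"
      by (intro d_lin_le_inverse assms(1)) auto
    then show ?case
      using elim by (simp add: powr_minus divide_inverse)
  qed
  with \<open>c > 0\<close> show "\<exists>c::real. c > 0 \<and>
           (\<forall>\<^sub>F n in sequentially.
              ereal (real n powr c) \<le> ereal_of_enat (r_even V E n) \<and>
              d_lin V E n \<le> real n powr (- c))"
    by blast
qed (rule r_even_ge[OF assms])

end
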